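(* Let $H$ be a separable infinite-dimensional Hilbert space, and let $(f_n)_{n=1}^\infty$ and $(g_n)_{n=1}^\infty$ be frames in $H$ that are dual to each other. Then $e((f_n)_{n=1}^\infty)=e((g_n)_{n=1}^\infty)$.
   Context: A sequence $(f_n)_{n=1}^\infty$ in $H$ is a frame if there exist constants $A,B>0$ with $A\|x\|^2\le\sum_{n=1}^\infty|\langle x,f_n\rangle|^2\le B\|x\|^2$ for all $x\in H$. A frame $(g_n)_{n=1}^\infty$ in $H$ is a dual frame of $(f_n)_{n=1}^\infty$ (the two frames are dual to each other) if $x=\sum_{n=1}^{\infty}\langle x,f_n\rangle g_n=\sum_{n=1}^{\infty}\langle x,g_n\rangle f_n$ for all $x\in H$. The excess $e((f_n)_{n=1}^\infty)$ of a frame is the greatest integer $k$ such that some $k$ elements can be deleted from the frame and still leave a complete set (a set whose closed linear span is $H$), or $+\infty$ if there is no upper bound to the number of elements that can be removed. *)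

theory Defs
  imports "HOL-Analysis.Analysis"
begin

text \<open>
  Scalars: the only models of the following class are the real and the complex
  numbers. By the Gelfand--Mazur theorem these are the only normed fields over the
  reals with a multiplicative norm, and the last axiom determines the conjugation.
\<close>

class hilbert_scalar = real_normed_field + banach +
  fixes cconj :: "'a \<Rightarrow> 'a"
  assumes cconj_add: "cconj (a + b) = cconj a + cconj b"
    and cconj_mult: "cconj (a * b) = cconj a * cconj b"
    and cconj_cconj: "cconj (cconj a) = a"
    and mult_cconj: "a * cconj a = (norm a)\<^sup>2 *\<^sub>R 1"

instantiation real :: hilbert_scalar
begin
definition cconj_real :: "real \<Rightarrow> real" where "cconj_real a = a"
instance by standard (simp_all add: cconj_real_def power2_eq_square)
end

instantiation complex :: hilbert_scalar
begin
definition cconj_complex :: "complex \<Rightarrow> complex" where "cconj_complex a = cnj a"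
instance by standard (simp_all add: cconj_complex_def scaleR_conv_of_real complex_norm_square del: of_real_power)
end

text \<open>
  A Hilbert space over \<open>'k\<close>, on the whole type \<open>'h\<close>. Completeness is part of the class
  \<^class>\<open>banach\<close>; the axioms say that the norm (hence the topology) of \<open>'h\<close> is the one
  given by the inner product, and that the real vector space structure of \<open>'h\<close> is the
  restriction of the scalar multiplication by \<open>'k\<close>. The inner product is linear
  in the first argument.
\<close>

locale hilbert_space = vector_space smul
  for smul :: "'k::hilbert_scalar \<Rightarrow> 'h::banach \<Rightarrow> 'h" +
  fixes ip :: "'h \<Rightarrow> 'h \<Rightarrow> 'k"
  assumes ip_add_left: "ip (x + y) z = ip x z + ip y z"
    and ip_smul_left: "ip (smul c x) y = c * ip x y"
    and ip_commute: "ip x y = cconj (ip y x)"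
    and ip_self: "ip x x = of_real ((norm x)\<^sup>2)"
    and smul_of_real: "smul (of_real r) x = r *\<^sub>R x"

lemma hilbert_space_real:
  "hilbert_space (scaleR :: real \<Rightarrow> 'h::{real_inner,banach} \<Rightarrow> 'h) inner"
  by unfold_locales
    (simp_all add: inner_add_left inner_add_right inner_commute cconj_real_def
      power2_norm_eq_inner scaleR_add_right scaleR_add_left)

lemma hilbert_space_complex:
  "hilbert_space ((*) :: complex \<Rightarrow> complex \<Rightarrow> complex) (\<lambda>x y. x * cnj y)"
  by unfold_locales
    (simp_all add: algebra_simps cconj_complex_def complex_norm_square scaleR_conv_of_real
      del: of_real_power)

definition infinite_dimensional :: "('k::field \<Rightarrow> 'h::ab_group_add \<Rightarrow> 'h) \<Rightarrow> bool" where
  "infinite_dimensional smul \<longleftrightarrow> \<not> (\<exists>B. finite B \<and> module.span smul B = UNIV)"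

text \<open>Sequences are indexed from 0.\<close>

definition frame :: "('h::real_normed_vector \<Rightarrow> 'h \<Rightarrow> 'k::hilbert_scalar) \<Rightarrow> (nat \<Rightarrow> 'h) \<Rightarrow> bool" where
  "frame ip f \<longleftrightarrow> (\<exists>A>0. \<exists>B>0. \<forall>x.
     summable (\<lambda>n. (norm (ip x (f n)))\<^sup>2) \<and>
     A * (norm x)\<^sup>2 \<le> (\<Sum>n. (norm (ip x (f n)))\<^sup>2) \<and>
     (\<Sum>n. (norm (ip x (f n)))\<^sup>2) \<le> B * (norm x)\<^sup>2)"

definition dual_frames ::
  "('k::hilbert_scalar \<Rightarrow> 'h::real_normed_vector \<Rightarrow> 'h) \<Rightarrow> ('h \<Rightarrow> 'h \<Rightarrow> 'k) \<Rightarrow>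
    (nat \<Rightarrow> 'h) \<Rightarrow> (nat \<Rightarrow> 'h) \<Rightarrow> bool" where
  "dual_frames smul ip f g \<longleftrightarrow> frame ip f \<and> frame ip g \<and>
     (\<forall>x. (\<lambda>n. smul (ip x (f n)) (g n)) sums x \<and>
          (\<lambda>n. smul (ip x (g n)) (f n)) sums x)"

definition complete_set ::
  "('k::field \<Rightarrow> 'h::{ab_group_add,topological_space} \<Rightarrow> 'h) \<Rightarrow> 'h set \<Rightarrow> bool" where
  "complete_set smul S \<longleftrightarrow> closure (module.span smul S) = UNIV"

text \<open>
  Elements are deleted by index: a vector occurring several times in the sequence
  is deleted one occurrence at a time.
\<close>

definition deletable ::
  "('k::field \<Rightarrow> 'h::{ab_group_add,topological_space} \<Rightarrow> 'h) \<Rightarrow> (nat \<Rightarrow> 'h) \<Rightarrow> nat \<Rightarrow> bool" where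
  "deletable smul f k \<longleftrightarrow>
     (\<exists>J. finite J \<and> card J = k \<and> complete_set smul (f ` (- J)))"

text \<open>
  For a frame, \<^term>\<open>deletable smul f 0\<close> holds, so that the greatest such number
  exists whenever there is an upper bound.
\<close>

definition excess ::
  "('k::field \<Rightarrow> 'h::{ab_group_add,topological_space} \<Rightarrow> 'h) \<Rightarrow> (nat \<Rightarrow> 'h) \<Rightarrow> enat" where
  "excess smul f =
     (if \<exists>b. \<forall>k. deletable smul f k \<longrightarrow> k \<le> b
      then enat (GREATEST k. deletable smul f k) else \<infinity>)"

end

theory Submission
  imports Defs
begin

text \<open>
  The idea is to read the excess off one infinite matrix, in such a way that exchanging
  \<open>f\<close> and \<open>g\<close> amounts to (conjugate) transposition. Let
  \<open>M i n = (if i = n then 1 else 0) - ip (g n) (f i)\<close>; this is the matrix of \<open>I - P\<close>, where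
  \<open>P\<close> is the projection in \<open>\<ell>\<^sup>2\<close> onto the range of the analysis operator of \<open>f\<close>, along the
  kernel of the synthesis operator of \<open>g\<close>.

  Deleting the indices in a finite set \<open>J\<close> from \<open>f\<close> can leave a complete set only if the columns
  of \<open>M\<close> indexed by \<open>J\<close> are linearly independent. Indeed a relation \<open>M c = 0\<close> with \<open>c\<close>
  supported in \<open>J\<close> says that \<open>c i = ip y (f i)\<close> for \<open>y = (\<Sum>n\<in>J. c n g n)\<close>; hence \<open>y\<close> is orthogonal to
  all the remaining vectors of \<open>f\<close>, so \<open>y = 0\<close> and \<open>c = 0\<close>
  (\<open>complete_set_imp_columns_independent\<close>).

  Conversely the columns of \<open>M\<close> are coefficients of vanishing series in \<open>g\<close>. If every prescribed
  tuple of values on a finite set \<open>R\<close> of rows is attained by a finite combination of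
  columns, then every expansion \<open>x = (\<Sum>i. ip x (f i) g i)\<close> can be corrected so that its
  coefficients vanish on \<open>R\<close>, and the indices in \<open>R\<close> can be deleted from \<open>g\<close>
  (\<open>rows_solvable_imp_complete_set\<close>).

  The link is that column rank is at most row rank: \<open>card J\<close> independent columns have \<open>card J\<close>
  rows on which they attain all values, also when there are infinitely many rows
  (\<open>independent_columns_imp_solvable_rows\<close>). Thus whatever number of elements can be deleted from
  \<open>f\<close> can be deleted from \<open>g\<close>, and duality is symmetric. Analysis enters only through
  the convergence of the dual expansions and the fact that only zero is orthogonal to a
  complete set.
\<close>

text \<open>
  Gaussian elimination with one pivot per step. Solvability for all right-hand sides, rather than
  independence of the rows, is the form in which the conclusion is applied, and it also
  shows by itself that the pivot row is not chosen again later on.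
\<close>

lemma independent_columns_imp_solvable_rows:
  fixes M :: "'r \<Rightarrow> 'c \<Rightarrow> 'a::field"
  assumes "finite J"
    and "\<And>c. (\<And>i. (\<Sum>n\<in>J. M i n * c n) = 0) \<Longrightarrow> \<forall>n\<in>J. c n = 0"
  shows "\<exists>R. finite R \<and> card R = card J \<and> (\<forall>b. \<exists>c. \<forall>i\<in>R. (\<Sum>n\<in>J. M i n * c n) = b i)"
  using assms
proof (induction J arbitrary: M rule: finite_induct)
  case empty
  then show ?case by (intro exI[of _ "{}"]) simp
next
  case (insert j J)
  have sum_upd: "(\<Sum>n\<in>J. M r n * (if n = j then t else c n)) = (\<Sum>n\<in>J. M r n * c n)" for r t c
    using insert.hyps by (intro sum.cong) auto
  obtain i where pivot: "M i j \<noteq> 0"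
  proof (rule ccontr)
    assume "\<not> thesis"
    then have "\<And>r. M r j = 0" using that by blast
    then have "(\<Sum>n\<in>insert j J. M r n * (if n = j then 1 else 0)) = 0" for r
      using insert.hyps sum_upd[of r 1 "\<lambda>_. 0"] by simp
    from insert.prems[OF this] show False by simp
  qed
  define M' where "M' r n = M r n - M r j / M i j * M i n" for r n
  have M'_sum: "(\<Sum>n\<in>J. M' r n * c n) =
      (\<Sum>n\<in>J. M r n * c n) - M r j / M i j * (\<Sum>n\<in>J. M i n * c n)" for r c
    by (simp add: M'_def left_diff_distrib sum_subtractf sum_distrib_left mult.assoc)
  have M'_pivot: "M' i n = 0" for n
    using pivot by (simp add: M'_def)
  have "\<forall>n\<in>J. c n = 0" if c: "\<And>r. (\<Sum>n\<in>J. M' r n * c n) = 0" for c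
  proof -
    \<comment> \<open>the coefficient of column \<open>j\<close> that the pivot equation forces\<close>
    define s where "s = - (\<Sum>n\<in>J. M i n * c n) / M i j"
    have "(\<Sum>n\<in>insert j J. M r n * (if n = j then s else c n)) = 0" for r
      using insert.hyps c[of r] unfolding M'_sum
      by (simp add: sum_upd s_def)
    from insert.prems[OF this] show ?thesis using insert.hyps by (metis insertCI)
  qed
  from insert.IH[of M', OF this] obtain R where R: "finite R" "card R = card J"
    and solve: "\<And>b. \<exists>c. \<forall>r\<in>R. (\<Sum>n\<in>J. M' r n * c n) = b r" by blast
  \<comment> \<open>the eliminated row is zero and hence cannot attain the value 1\<close>
  have "i \<notin> R"
    using solve[of "\<lambda>_. 1"] by (auto simp: M'_pivot)
  have "\<exists>c. \<forall>r\<in>insert i R. (\<Sum>n\<in>insert j J. M r n * c n) = b r" for b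
  proof -
    obtain c where c: "\<forall>r\<in>R. (\<Sum>n\<in>J. M' r n * c n) = b r - M r j / M i j * b i"
      using solve[of "\<lambda>r. b r - M r j / M i j * b i"] by blast
    \<comment> \<open>back substitution: \<open>t\<close> is chosen to satisfy the pivot equation\<close>
    define t where "t = (b i - (\<Sum>n\<in>J. M i n * c n)) / M i j"
    have total: "(\<Sum>n\<in>insert j J. M r n * (if n = j then t else c n)) =
        M r j * t + (\<Sum>n\<in>J. M r n * c n)" for r
      using insert.hyps by (simp add: sum_upd)
    have "M i j * t + (\<Sum>n\<in>J. M i n * c n) = b i"
      using pivot by (simp add: t_def)
    moreover have "M r j * t + (\<Sum>n\<in>J. M r n * c n) = b r" if "r \<in> R" for r
      using bspec[OF c that] unfolding M'_sum t_def
      by (simp add: algebra_simps diff_divide_distrib)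
    ultimately show ?thesis
      unfolding total[symmetric] by (intro exI[of _ "\<lambda>n. if n = j then t else c n"]) blast
  qed
  with R \<open>i \<notin> R\<close> insert.hyps show ?case
    by (intro exI[of _ "insert i R"]) simp
qed

context hilbert_space
begin

lemma ip_zero_left: "ip 0 z = 0"
  using ip_add_left[of 0 0 z] by simp

lemma ip_sum_left: "ip (\<Sum>n\<in>A. x n) z = (\<Sum>n\<in>A. ip (x n) z)"
  by (induction A rule: infinite_finite_induct) (simp_all add: ip_zero_left ip_add_left)

lemma cconj_zero: "cconj (0::'k) = 0"
  using cconj_add[of "0::'k" 0] by simp

lemma ip_eq_0_commute: "ip x y = 0 \<longleftrightarrow> ip y x = 0"
  using ip_commute[of x y] ip_commute[of y x] by (auto simp: cconj_zero)

lemma orthogonal_span_left: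
  assumes "z \<in> module.span smul S" and "\<And>s. s \<in> S \<Longrightarrow> ip s y = 0"
  shows "ip z y = 0"
  using assms(1)
proof (induction rule: span_induct_alt)
  case base
  show ?case by (rule ip_zero_left)
next
  case (step c s z)
  then show ?case using assms(2) by (simp add: ip_add_left ip_smul_left)
qed

lemma norm_le_norm_add_if_orthogonal:
  assumes "ip x y = 0"
  shows "norm y \<le> norm (x + y)"
proof -
  have "ip (x + y) (x + y) = ip x (x + y) + ip y (x + y)"
    by (rule ip_add_left)
  also have "ip x (x + y) = cconj (ip x x + ip y x)"
    by (subst ip_commute) (simp add: ip_add_left)
  also have "\<dots> = ip x x"
    using assms ip_eq_0_commute[of x y] ip_commute[of x x] by simp
  also have "ip y (x + y) = cconj (ip x y + ip y y)"
    by (subst ip_commute) (simp add: ip_add_left)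
  also have "\<dots> = ip y y"
    using assms ip_commute[of y y] by simp
  finally have "of_real ((norm (x + y))\<^sup>2) = (of_real ((norm x)\<^sup>2 + (norm y)\<^sup>2) :: 'k)"
    by (simp add: ip_self)
  then have "(norm (x + y))\<^sup>2 = (norm x)\<^sup>2 + (norm y)\<^sup>2"
    by (simp only: of_real_eq_iff)
  then have "(norm y)\<^sup>2 \<le> (norm (x + y))\<^sup>2" by simp
  then show ?thesis by (rule power2_le_imp_le) simp
qed

text \<open>
  A vector \<open>y\<close> orthogonal to \<open>S\<close> has distance at least \<open>norm y\<close> from the span of \<open>S\<close>, by
  Pythagoras, while a complete set approximates it.
\<close>

lemma orthogonal_complete_set_eq_0:
  assumes "complete_set smul S" and "\<And>s. s \<in> S \<Longrightarrow> ip s y = 0"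
  shows "y = 0"
proof (rule ccontr)
  assume "y \<noteq> 0"
  have "y \<in> closure (module.span smul S)"
    using assms(1) by (simp add: complete_set_def)
  then obtain z where z: "z \<in> module.span smul S" "dist z y < norm y"
    using \<open>y \<noteq> 0\<close> by (metis closure_approachable zero_less_norm_iff)
  have "ip (- z) y = 0"
    using orthogonal_span_left[OF span_neg[OF z(1)] assms(2)] .
  from norm_le_norm_add_if_orthogonal[OF this] z(2) show False
    by (simp add: dist_norm norm_minus_commute)
qed

text \<open>
  The equation \<open>ip (\<Sum>n\<in>J. smul (c n) (g n)) (f i) = (if i \<in> J then c i else 0)\<close> is the condition
  that \<open>c\<close>, extended by zero, is a fixed vector of the matrix \<open>ip (g n) (f i)\<close>.
\<close>

lemma complete_set_imp_columns_independent:
  fixes f g :: "nat \<Rightarrow> 'h"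
  assumes "complete_set smul (f ` (- J))"
    and fixed: "\<And>i. ip (\<Sum>n\<in>J. smul (c n) (g n)) (f i) = (if i \<in> J then c i else 0)"
  shows "\<forall>n\<in>J. c n = 0"
proof -
  have "ip s (\<Sum>n\<in>J. smul (c n) (g n)) = 0" if "s \<in> f ` (- J)" for s
    using that fixed by (auto simp: ip_eq_0_commute[of s])
  from orthogonal_complete_set_eq_0[OF assms(1) this]
  have "(\<Sum>n\<in>J. smul (c n) (g n)) = 0" .
  with fixed show ?thesis by (metis ip_zero_left)
qed

text \<open>
  With \<open>y = (\<Sum>n\<in>J. c n g n)\<close>, subtracting this finite sum from the expansion of \<open>x + y\<close> gives
  another series in \<open>g\<close> with sum \<open>x\<close>. The hypothesis allows \<open>c\<close> to be chosen such that the
  coefficients of the new series vanish on \<open>R\<close>.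
\<close>

lemma rows_solvable_imp_complete_set:
  fixes f g :: "nat \<Rightarrow> 'h"
  assumes expand: "\<And>x. (\<lambda>n. smul (ip x (f n)) (g n)) sums x"
    and "finite J"
    and solve: "\<And>b. \<exists>c. \<forall>i\<in>R.
      (if i \<in> J then c i else 0) - ip (\<Sum>n\<in>J. smul (c n) (g n)) (f i) = b i"
  shows "complete_set smul (g ` (- R))"
proof -
  have "x \<in> closure (module.span smul (g ` (- R)))" for x
  proof -
    obtain c where c: "\<forall>i\<in>R.
        (if i \<in> J then c i else 0) - ip (\<Sum>n\<in>J. smul (c n) (g n)) (f i) = ip x (f i)"
      using solve[of "\<lambda>i. ip x (f i)"] by blast
    define y where "y = (\<Sum>n\<in>J. smul (c n) (g n))"
    define d where "d i = ip (x + y) (f i) - (if i \<in> J then c i else 0)" for i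
    have "(\<lambda>i. if i \<in> J then smul (c i) (g i) else 0) sums y"
      unfolding y_def using \<open>finite J\<close> by (rule sums_If_finite_set)
    note sums_diff[OF expand[of "x + y"] this]
    moreover have "smul (d i) (g i) =
        smul (ip (x + y) (f i)) (g i) - (if i \<in> J then smul (c i) (g i) else 0)" for i
      by (simp add: d_def scale_left_diff_distrib)
    ultimately have "(\<lambda>i. smul (d i) (g i)) sums x"
      by simp
    then have "(\<lambda>N. \<Sum>i<N. smul (d i) (g i)) \<longlonglongrightarrow> x"
      by (simp add: sums_def)
    moreover have "(\<Sum>i<N. smul (d i) (g i)) \<in> module.span smul (g ` (- R))" for N
    proof (rule span_sum)
      fix i
      have "d i = 0" if "i \<in> R"
        using bspec[OF c that] by (simp add: d_def y_def ip_add_left algebra_simps)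
      then show "smul (d i) (g i) \<in> module.span smul (g ` (- R))"
        by (cases "i \<in> R") (auto intro: span_scale span_base span_zero)
    qed
    ultimately show ?thesis
      unfolding closure_sequential by (intro exI conjI allI)
  qed
  then show ?thesis by (auto simp: complete_set_def)
qed

text \<open>
  Only the expansions with coefficients from \<open>f\<close> occur here; those with coefficients from \<open>g\<close>
  give the converse by exchanging the two sequences.
\<close>

lemma deletable_dual:
  fixes f g :: "nat \<Rightarrow> 'h"
  assumes expand: "\<And>x. (\<lambda>n. smul (ip x (f n)) (g n)) sums x"
    and "deletable smul f k"
  shows "deletable smul g k"
proof -
  obtain J where J: "finite J" "card J = k" "complete_set smul (f ` (- J))"
    using assms(2) by (auto simp: deletable_def)
  define M where "M i n = (if i = n then 1 else 0) - ip (g n) (f i)" for i n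
  have M_sum: "(\<Sum>n\<in>J. M i n * c n) =
      (if i \<in> J then c i else 0) - ip (\<Sum>n\<in>J. smul (c n) (g n)) (f i)" for i c
  proof -
    have "(\<Sum>n\<in>J. M i n * c n) =
        (\<Sum>n\<in>J. (if i = n then c n else 0) - c n * ip (g n) (f i))"
      by (intro sum.cong) (auto simp: M_def algebra_simps)
    also have "\<dots> = (if i \<in> J then c i else 0) - (\<Sum>n\<in>J. c n * ip (g n) (f i))"
      using J(1) by (simp add: sum_subtractf)
    finally show ?thesis by (simp add: ip_sum_left ip_smul_left)
  qed
  have independent: "\<forall>n\<in>J. c n = 0" if "\<And>i. (\<Sum>n\<in>J. M i n * c n) = 0" for c
    using that unfolding M_sum
    by (intro complete_set_imp_columns_independent[OF J(3), of c g]) simp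
  have "\<exists>R. finite R \<and> card R = card J \<and>
      (\<forall>b. \<exists>c. \<forall>i\<in>R. (\<Sum>n\<in>J. M i n * c n) = b i)"
    using J(1) independent by (rule independent_columns_imp_solvable_rows)
  then obtain R where R: "finite R" "card R = card J"
    and solve: "\<forall>b. \<exists>c. \<forall>i\<in>R. (\<Sum>n\<in>J. M i n * c n) = b i" by (elim exE conjE)
  have "complete_set smul (g ` (- R))"
    by (rule rows_solvable_imp_complete_set[OF expand J(1) solve[unfolded M_sum, rule_format]])
  with R J(2) show ?thesis by (auto simp: deletable_def)
qed

end

theorem theorem2p2:
  fixes smul :: "'k::hilbert_scalar \<Rightarrow> 'h::banach \<Rightarrow> 'h"
    and ip :: "'h \<Rightarrow> 'h \<Rightarrow> 'k"
    and f g :: "nat \<Rightarrow> 'h"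
  assumes "hilbert_space smul ip"
    and "separable_space (euclidean :: 'h topology)"
    and "infinite_dimensional smul"
    and "frame ip f"
    and "frame ip g"
    and "dual_frames smul ip f g"
  shows "excess smul f = excess smul g"
proof -
  have "(\<lambda>n. smul (ip x (f n)) (g n)) sums x" "(\<lambda>n. smul (ip x (g n)) (f n)) sums x" for x
    using assms(6) by (auto simp: dual_frames_def)
  then have "deletable smul f = deletable smul g"
    using hilbert_space.deletable_dual[OF assms(1)] by (intro ext) blast
  then show ?thesis by (simp add: excess_def)
qed

end
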